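(* The category of ball spaces admits products and coproducts.
   Context: A ball space is a pair $(X,\mathcal{B})$ where $X$ is a nonempty set and $\mathcal{B}$ is a nonempty set of nonempty subsets of $X$; the elements of $\mathcal{B}$ are called balls. A function $f:X\to X'$ is ball continuous from $(X,\mathcal{B})$ to $(X',\mathcal{B}')$ if $f^{-1}(B')\in\mathcal{B}$ for every $B'\in\mathcal{B}'$. The category of ball spaces consists of all ball spaces as objects and the ball continuous functions between them as morphisms. Products and coproducts are meant in the sense of category theory, for ball spaces $(Y_i,\mathcal{B}_i)$, $i\in I$.
   Formalization: Products and coproducts are proved for families indexed by a nonempty set I; for empty I the claim is false, since the category of ball spaces has neither a terminal nor an initial object. *)

theory Defs
  imports "HOL-Library.FuncSet"
begin

type_synonym 'a bspace = "'a set \<times> 'a set set"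

abbreviation points :: "'a bspace \<Rightarrow> 'a set"
  where "points \<equiv> fst"

abbreviation balls :: "'a bspace \<Rightarrow> 'a set set"
  where "balls \<equiv> snd"

definition ball_space :: "'a bspace \<Rightarrow> bool" where
  "ball_space Y \<longleftrightarrow> points Y \<noteq> {} \<and> balls Y \<noteq> {} \<and>
     (\<forall>B\<in>balls Y. B \<subseteq> points Y \<and> B \<noteq> {})"

text \<open>Morphisms are extensional functions, so that equality of morphisms is
  equality in HOL. Their identities are \<open>restrict id (points Y)\<close>, and
  composition is \<open>compose\<close> relative to the domain of the inner function.\<close>

definition ball_hom :: "'a bspace \<Rightarrow> 'b bspace \<Rightarrow> ('a \<Rightarrow> 'b) set" where
  "ball_hom Y Y' = {f \<in> points Y \<rightarrow>\<^sub>E points Y'.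
     \<forall>B'\<in>balls Y'. f -` B' \<inter> points Y \<in> balls Y}"

lemma ball_hom_id:
  assumes "ball_space Y"
  shows "restrict id (points Y) \<in> ball_hom Y Y"
proof -
  have "restrict id (points Y) -` B \<inter> points Y = B" if "B \<in> balls Y" for B
  proof -
    have "B \<subseteq> points Y" using assms that unfolding ball_space_def by blast
    then show ?thesis by (auto simp: restrict_def)
  qed
  then show ?thesis by (auto simp: ball_hom_def)
qed

lemma ball_hom_compose:
  assumes "f \<in> ball_hom X Y" and "g \<in> ball_hom Y Z"
  shows "compose (points X) g f \<in> ball_hom X Z"
proof -
  have "compose (points X) g f -` B \<inter> points X = f -` (g -` B \<inter> points Y) \<inter> points X" for B
    using assms by (auto simp: ball_hom_def compose_def)
  moreover have "f -` (g -` B \<inter> points Y) \<inter> points X \<in> balls X" if "B \<in> balls Z" for B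
    using assms that unfolding ball_hom_def by blast
  moreover have "compose (points X) g f \<in> points X \<rightarrow>\<^sub>E points Z"
    using assms by (auto simp: ball_hom_def compose_def)
  ultimately show ?thesis unfolding ball_hom_def by simp
qed

text \<open>The universal properties range over all test objects \<open>Z\<close>. HOL cannot quantify
  over their type inside a formula, so it is an explicit parameter; a
  (co)product is an object and a family of morphisms satisfying the property for
  every \<open>'z\<close>.\<close>

definition is_ball_product ::
  "'z itself \<Rightarrow> 'i set \<Rightarrow> ('i \<Rightarrow> 'a bspace) \<Rightarrow> 'p bspace \<Rightarrow> ('i \<Rightarrow> 'p \<Rightarrow> 'a) \<Rightarrow> bool" where
  "is_ball_product _ I Y P p \<longleftrightarrow>
     ball_space P \<and> (\<forall>i\<in>I. p i \<in> ball_hom P (Y i)) \<and>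
     (\<forall>(Z :: 'z bspace) f. ball_space Z \<longrightarrow> (\<forall>i\<in>I. f i \<in> ball_hom Z (Y i)) \<longrightarrow>
        (\<exists>!h. h \<in> ball_hom Z P \<and> (\<forall>i\<in>I. compose (points Z) (p i) h = f i)))"

definition is_ball_coproduct ::
  "'z itself \<Rightarrow> 'i set \<Rightarrow> ('i \<Rightarrow> 'a bspace) \<Rightarrow> 'c bspace \<Rightarrow> ('i \<Rightarrow> 'a \<Rightarrow> 'c) \<Rightarrow> bool" where
  "is_ball_coproduct _ I Y C q \<longleftrightarrow>
     ball_space C \<and> (\<forall>i\<in>I. q i \<in> ball_hom (Y i) C) \<and>
     (\<forall>(Z :: 'z bspace) f. ball_space Z \<longrightarrow> (\<forall>i\<in>I. f i \<in> ball_hom (Y i) Z) \<longrightarrow>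
        (\<exists>!h. h \<in> ball_hom C Z \<and> (\<forall>i\<in>I. compose (points (Y i)) h (q i) = f i)))"

text \<open>The witnesses are given as explicit terms whose types do not mention \<open>'z\<close>:
  an existential quantifier in a statement polymorphic in \<open>'z\<close> would allow
  the object to depend on the type of the test objects.\<close>

definition ball_product :: "'i set \<Rightarrow> ('i \<Rightarrow> 'a bspace) \<Rightarrow> ('i \<Rightarrow> 'a) bspace" where
  "ball_product I Y =
     (\<Pi>\<^sub>E i\<in>I. points (Y i),
      {{x \<in> \<Pi>\<^sub>E j\<in>I. points (Y j). x i \<in> B} | i B. i \<in> I \<and> B \<in> balls (Y i)})"

definition ball_proj :: "'i set \<Rightarrow> ('i \<Rightarrow> 'a bspace) \<Rightarrow> 'i \<Rightarrow> ('i \<Rightarrow> 'a) \<Rightarrow> 'a" where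
  "ball_proj I Y i = (\<lambda>x\<in>points (ball_product I Y). x i)"

text \<open>A ball of the coproduct meets every summand in a ball of that summand: a
  union of balls over only some of the summands would have an empty, hence inadmissible,
  preimage under the remaining injections.\<close>

definition ball_coproduct :: "'i set \<Rightarrow> ('i \<Rightarrow> 'a bspace) \<Rightarrow> ('i \<times> 'a) bspace" where
  "ball_coproduct I Y =
     (SIGMA i:I. points (Y i),
      {SIGMA i:I. S i | S. \<forall>i\<in>I. S i \<in> balls (Y i)})"

definition ball_inj :: "('i \<Rightarrow> 'a bspace) \<Rightarrow> 'i \<Rightarrow> 'a \<Rightarrow> 'i \<times> 'a" where
  "ball_inj Y i = (\<lambda>x\<in>points (Y i). (i, x))"

end

theory Submission
  imports Defs
begin

text \<open>On underlying sets the universal objects are the cartesian product and the disjoint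
  union, so mediating maps exist and are unique as for sets; the task is to choose the balls. The
  product carries the smallest set of balls making all projections ball continuous, namely the
  preimages of balls under single projections. A map into it is then ball continuous once its
  components are, since its preimage of such a ball is a preimage under one component
  (\<open>ball_product_universal\<close>). Dually, the coproduct carries the largest set of balls
  making all injections ball continuous: the sets meeting every summand in a ball. A map out of it
  is ball continuous once its restrictions to the summands are
  (\<open>ball_coproduct_universal\<close>). That both objects are ball spaces rests on
  \<open>I\<close> being nonempty and on choice.\<close>

lemma ball_homI:
  assumes "f \<in> points Y \<rightarrow>\<^sub>E points Y'"
    and "\<And>B. B \<in> balls Y' \<Longrightarrow> f -` B \<inter> points Y \<in> balls Y"
  shows "f \<in> ball_hom Y Y'"
  using assms by (simp add: ball_hom_def)

lemma ball_hom_PiE: "f \<in> ball_hom Y Y' \<Longrightarrow> f \<in> points Y \<rightarrow>\<^sub>E points Y'"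
  by (simp add: ball_hom_def)

lemma ball_hom_apply: "f \<in> ball_hom Y Y' \<Longrightarrow> x \<in> points Y \<Longrightarrow> f x \<in> points Y'"
  using ball_hom_PiE by (rule PiE_mem)

lemma ball_hom_arb: "f \<in> ball_hom Y Y' \<Longrightarrow> x \<notin> points Y \<Longrightarrow> f x = undefined"
  using ball_hom_PiE by (rule PiE_arb)

lemma ball_hom_vimage:
  "f \<in> ball_hom Y Y' \<Longrightarrow> B \<in> balls Y' \<Longrightarrow> f -` B \<inter> points Y \<in> balls Y"
  by (simp add: ball_hom_def)

lemma points_ball_product: "points (ball_product I Y) = (\<Pi>\<^sub>E i\<in>I. points (Y i))"
  by (simp add: ball_product_def)

lemma balls_ball_product:
  "balls (ball_product I Y) =
     {{x \<in> \<Pi>\<^sub>E j\<in>I. points (Y j). x i \<in> B} | i B. i \<in> I \<and> B \<in> balls (Y i)}"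
  by (simp add: ball_product_def)

lemma points_ball_coproduct: "points (ball_coproduct I Y) = (SIGMA i:I. points (Y i))"
  by (simp add: ball_coproduct_def)

lemma balls_ball_coproduct:
  "balls (ball_coproduct I Y) = {SIGMA i:I. S i | S. \<forall>i\<in>I. S i \<in> balls (Y i)}"
  by (simp add: ball_coproduct_def)

lemma ball_space_ball_product:
  assumes "I \<noteq> {}" and Y: "\<forall>i\<in>I. ball_space (Y i)"
  shows "ball_space (ball_product I Y)"
proof -
  \<comment> \<open>The axiom of choice, in the form of \<open>PiE_eq_empty_iff\<close>.\<close>
  have "(\<Pi>\<^sub>E i\<in>I. points (Y i)) \<noteq> {}"
    using Y by (simp add: PiE_eq_empty_iff ball_space_def)
  then obtain z where z: "z \<in> (\<Pi>\<^sub>E i\<in>I. points (Y i))" by blast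
  have "{x \<in> \<Pi>\<^sub>E j\<in>I. points (Y j). x i \<in> B} \<noteq> {}" if "i \<in> I" "B \<in> balls (Y i)" for i B
  proof -
    have "B \<subseteq> points (Y i)" "B \<noteq> {}"
      using Y that by (auto simp: ball_space_def)
    then obtain b where b: "b \<in> B" "b \<in> points (Y i)" by blast
    \<comment> \<open>A ball constrains a single coordinate, so changing \<open>z\<close> there
      moves it into the ball.\<close>
    then have "z(i := b) \<in> (\<Pi>\<^sub>E j\<in>I. points (Y j))"
      using z \<open>i \<in> I\<close> by (auto simp: PiE_iff extensional_def)
    with b show ?thesis by fastforce
  qed
  then have "\<forall>B\<in>balls (ball_product I Y). B \<subseteq> points (ball_product I Y) \<and> B \<noteq> {}"
    unfolding points_ball_product balls_ball_product by auto
  moreover have "balls (ball_product I Y) \<noteq> {}"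
  proof -
    obtain i where "i \<in> I" using assms by blast
    moreover from this obtain B where "B \<in> balls (Y i)"
      using Y unfolding ball_space_def by blast
    ultimately show ?thesis unfolding balls_ball_product by blast
  qed
  moreover have "points (ball_product I Y) \<noteq> {}"
    using z unfolding points_ball_product by blast
  ultimately show ?thesis unfolding ball_space_def by simp
qed

lemma ball_proj_hom:
  assumes "i \<in> I"
  shows "ball_proj I Y i \<in> ball_hom (ball_product I Y) (Y i)"
proof (rule ball_homI)
  show "ball_proj I Y i \<in> points (ball_product I Y) \<rightarrow>\<^sub>E points (Y i)"
    using assms by (auto simp: ball_proj_def points_ball_product)
next
  fix B assume "B \<in> balls (Y i)"
  moreover have "ball_proj I Y i -` B \<inter> points (ball_product I Y)
      = {x \<in> \<Pi>\<^sub>E j\<in>I. points (Y j). x i \<in> B}"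
    by (auto simp: ball_proj_def points_ball_product)
  ultimately show "ball_proj I Y i -` B \<inter> points (ball_product I Y) \<in> balls (ball_product I Y)"
    using assms unfolding balls_ball_product by blast
qed

text \<open>The projections prescribe every coordinate, so the only candidate is the tuple of the
  \<open>f i\<close>. Each ball tests one coordinate, which reduces its ball continuity to that of
  one \<open>f i\<close>.\<close>

lemma ball_product_universal:
  fixes Z :: "'z bspace"
  assumes f: "\<forall>i\<in>I. f i \<in> ball_hom Z (Y i)"
  shows "\<exists>!h. h \<in> ball_hom Z (ball_product I Y) \<and>
           (\<forall>i\<in>I. compose (points Z) (ball_proj I Y i) h = f i)"
proof -
  define h where "h = (\<lambda>z\<in>points Z. \<lambda>i\<in>I. f i z)"
  have h_PiE: "h \<in> points Z \<rightarrow>\<^sub>E points (ball_product I Y)"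
    using f by (auto simp: h_def points_ball_product ball_hom_apply)
  have "h \<in> ball_hom Z (ball_product I Y)"
  proof (rule ball_homI[OF h_PiE])
    fix B assume "B \<in> balls (ball_product I Y)"
    then obtain i C where i: "i \<in> I" and C: "C \<in> balls (Y i)"
      and B: "B = {x \<in> \<Pi>\<^sub>E j\<in>I. points (Y j). x i \<in> C}"
      unfolding balls_ball_product by blast
    \<comment> \<open>Since \<open>h\<close> already maps into the product, membership in
      \<open>B\<close> only asks that coordinate \<open>i\<close> lie in \<open>C\<close>.\<close>
    have "h -` B \<inter> points Z = f i -` C \<inter> points Z"
      using i PiE_mem[OF h_PiE] by (auto simp: B h_def points_ball_product)
    moreover have "f i -` C \<inter> points Z \<in> balls Z"
      using bspec[OF f i] C by (rule ball_hom_vimage)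
    ultimately show "h -` B \<inter> points Z \<in> balls Z" by (rule ssubst)
  qed
  moreover have "compose (points Z) (ball_proj I Y i) h = f i" if "i \<in> I" for i
  proof
    fix z
    show "compose (points Z) (ball_proj I Y i) h z = f i z"
    proof (cases "z \<in> points Z")
      case True
      with that PiE_mem[OF h_PiE True] show ?thesis
        by (simp add: compose_def ball_proj_def) (simp add: h_def)
    next
      case False
      \<comment> \<open>Off the domain both sides take the default value
        \<open>undefined\<close>.\<close>
      with ball_hom_arb[OF bspec[OF f that] False] show ?thesis by (simp add: compose_def)
    qed
  qed
  moreover have "g = h" if g: "g \<in> ball_hom Z (ball_product I Y)"
    and comp: "\<forall>i\<in>I. compose (points Z) (ball_proj I Y i) g = f i" for g
  proof (rule PiE_ext[OF ball_hom_PiE[OF g] h_PiE])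
    fix z assume z: "z \<in> points Z"
    have gz: "g z \<in> points (ball_product I Y)" using g z by (rule ball_hom_apply)
    have "g z i = f i z" if "i \<in> I" for i
      using fun_cong[OF bspec[OF comp that], of z] z gz by (simp add: compose_def ball_proj_def)
    \<comment> \<open>Coordinates outside \<open>I\<close> are fixed by extensionality of the points
      of the product.\<close>
    moreover have "g z i = undefined" if "i \<notin> I" for i
      using gz that unfolding points_ball_product by (rule PiE_arb)
    ultimately show "g z = h z"
      using z by (auto simp: h_def)
  qed
  ultimately show ?thesis by blast
qed

lemma ball_space_ball_coproduct:
  assumes "I \<noteq> {}" and Y: "\<forall>i\<in>I. ball_space (Y i)"
  shows "ball_space (ball_coproduct I Y)"
proof -
  obtain i where i: "i \<in> I" using assms by blast
  have "\<forall>i\<in>I. \<exists>B. B \<in> balls (Y i)"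
    using Y unfolding ball_space_def by blast
  \<comment> \<open>Choice again: one ball from every summand, together forming a ball of the
    coproduct.\<close>
  then obtain S where "\<forall>i\<in>I. S i \<in> balls (Y i)" by metis
  then have "balls (ball_coproduct I Y) \<noteq> {}"
    unfolding balls_ball_coproduct by blast
  moreover have "points (ball_coproduct I Y) \<noteq> {}"
    using Y i unfolding points_ball_coproduct ball_space_def by blast
  moreover have "(SIGMA i:I. S i) \<noteq> {} \<and> (SIGMA i:I. S i) \<subseteq> points (ball_coproduct I Y)"
    if "\<forall>i\<in>I. S i \<in> balls (Y i)" for S
    using Y i that unfolding points_ball_coproduct ball_space_def by blast
  ultimately show ?thesis
    unfolding ball_space_def balls_ball_coproduct by blast
qed

text \<open>Pulling a ball back along injection \<open>i\<close> returns its component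
  \<open>S i\<close>; that balls of \<open>Y i\<close> consist of points of \<open>Y i\<close>
  ensures that intersecting with the domain loses nothing.\<close>

lemma ball_inj_hom:
  assumes "i \<in> I" and "ball_space (Y i)"
  shows "ball_inj Y i \<in> ball_hom (Y i) (ball_coproduct I Y)"
proof (rule ball_homI)
  show "ball_inj Y i \<in> points (Y i) \<rightarrow>\<^sub>E points (ball_coproduct I Y)"
    using assms by (auto simp: ball_inj_def points_ball_coproduct)
next
  fix B assume "B \<in> balls (ball_coproduct I Y)"
  then obtain S where S: "\<forall>i\<in>I. S i \<in> balls (Y i)" and B: "B = (SIGMA i:I. S i)"
    unfolding balls_ball_coproduct by blast
  have "S i \<subseteq> points (Y i)"
    using assms S unfolding ball_space_def by blast
  then have "ball_inj Y i -` B \<inter> points (Y i) = S i"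
    using assms by (auto simp: ball_inj_def B)
  then show "ball_inj Y i -` B \<inter> points (Y i) \<in> balls (Y i)"
    using assms S by simp
qed

text \<open>The summands are disjoint, so the \<open>f i\<close> glue to one map. Its preimage of a
  ball meets summand \<open>i\<close> in the preimage under \<open>f i\<close>, and having a ball in
  every summand is exactly what a ball of the coproduct requires.\<close>

lemma ball_coproduct_universal:
  fixes Z :: "'z bspace"
  assumes f: "\<forall>i\<in>I. f i \<in> ball_hom (Y i) Z"
  shows "\<exists>!h. h \<in> ball_hom (ball_coproduct I Y) Z \<and>
           (\<forall>i\<in>I. compose (points (Y i)) h (ball_inj Y i) = f i)"
proof -
  define h where "h = (\<lambda>(i, x)\<in>points (ball_coproduct I Y). f i x)"
  have h_PiE: "h \<in> points (ball_coproduct I Y) \<rightarrow>\<^sub>E points Z"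
    using f by (auto simp: h_def points_ball_coproduct ball_hom_apply)
  have "h \<in> ball_hom (ball_coproduct I Y) Z"
  proof (rule ball_homI[OF h_PiE])
    fix B assume B: "B \<in> balls Z"
    have "h -` B \<inter> points (ball_coproduct I Y) = (SIGMA i:I. f i -` B \<inter> points (Y i))"
      by (auto simp: h_def points_ball_coproduct)
    moreover have "\<forall>i\<in>I. f i -` B \<inter> points (Y i) \<in> balls (Y i)"
      using f B by (blast intro: ball_hom_vimage)
    ultimately show "h -` B \<inter> points (ball_coproduct I Y) \<in> balls (ball_coproduct I Y)"
      unfolding balls_ball_coproduct by blast
  qed
  moreover have "compose (points (Y i)) h (ball_inj Y i) = f i" if "i \<in> I" for i
  proof
    fix x
    show "compose (points (Y i)) h (ball_inj Y i) x = f i x"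
      \<comment> \<open>\<open>ball_hom_arb\<close> covers the points outside \<open>Y i\<close>,
        where both sides are \<open>undefined\<close>.\<close>
      using ball_hom_arb[OF bspec[OF f that], of x] that
      by (simp add: compose_def ball_inj_def h_def points_ball_coproduct)
  qed
  moreover have "g = h" if g: "g \<in> ball_hom (ball_coproduct I Y) Z"
    and comp: "\<forall>i\<in>I. compose (points (Y i)) g (ball_inj Y i) = f i" for g
  proof (rule PiE_ext[OF ball_hom_PiE[OF g] h_PiE])
    fix p assume "p \<in> points (ball_coproduct I Y)"
    then obtain i x where p: "p = (i, x)" and i: "i \<in> I" and x: "x \<in> points (Y i)"
      unfolding points_ball_coproduct by blast
    show "g p = h p"
      \<comment> \<open>Every point of the coproduct is the image of some \<open>x\<close> under an
        injection, so the equation for that injection determines \<open>g\<close> there.\<close>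
      using fun_cong[OF bspec[OF comp i], of x] i x
      by (simp add: compose_def ball_inj_def h_def p points_ball_coproduct)
  qed
  ultimately show ?thesis by blast
qed

theorem theorem11:
  fixes I :: "'i set" and Y :: "'i \<Rightarrow> 'a bspace"
  assumes "I \<noteq> {}" and "\<forall>i\<in>I. ball_space (Y i)"
  shows "is_ball_product TYPE('z) I Y (ball_product I Y) (ball_proj I Y) \<and>
         is_ball_coproduct TYPE('z) I Y (ball_coproduct I Y) (ball_inj Y)"
proof
  show "is_ball_product TYPE('z) I Y (ball_product I Y) (ball_proj I Y)"
    unfolding is_ball_product_def
    by (intro conjI allI impI ballI ball_space_ball_product[OF assms] ball_proj_hom
        ball_product_universal) blast+
  show "is_ball_coproduct TYPE('z) I Y (ball_coproduct I Y) (ball_inj Y)"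
    unfolding is_ball_coproduct_def
    using assms(2)
    by (intro conjI allI impI ballI ball_space_ball_coproduct[OF assms] ball_inj_hom
        ball_coproduct_universal) blast+
qed

end
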